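(* Let $H$ be a complex vector space with scalar product $(\cdot|\cdot)$, let $A$ and $B$ be symmetric operators in $H$ with domains $D(A)$ and $D(B)$, and let $M = D(A)\cap D(B)$, where $M\neq\{0\}$. Let $\varphi\in M$ satisfy $A\varphi\neq 0$ and $B\varphi\neq 0$. Then the following equalities hold. (1) For each choice of sign (upper signs together, or lower signs together), $$\pm i([A,B]\varphi|\varphi)=\|A\varphi\|\|B\varphi\|\left(2-\left\|\frac{A\varphi}{\|A\varphi\|}\mp i\frac{B\varphi}{\|B\varphi\|}\right\|^2\right).$$ (2) For each choice of sign (upper signs together, or lower signs together), $$\pm(\{A,B\}\varphi|\varphi)=\|A\varphi\|\|B\varphi\|\left(2-\left\|\frac{A\varphi}{\|A\varphi\|}\mp\frac{B\varphi}{\|B\varphi\|}\right\|^2\right).$$ (3) For every $\theta\in\mathbb{R}$ and each choice of the sign $\pm$, $$\begin{aligned}|(A\varphi|B\varphi)|&=\frac12\Bigl(|([A,B]\varphi|\varphi)|^2+|(\{A,B\}\varphi|\varphi)|^2\Bigr)^{1/2}\\&=\|A\varphi\|\|B\varphi\|\left[\left(1-\frac12\left\|\frac{A\varphi}{\|A\varphi\|}+e^{i\theta}\frac{B\varphi}{\|B\varphi\|}\right\|^2\right)^2+\left(1-\frac12\left\|\frac{A\varphi}{\|A\varphi\|}\pm ie^{i\theta}\frac{B\varphi}{\|B\varphi\|}\right\|^2\right)^2\right]^{1/2}\\&=\|A\varphi\|\|B\varphi\|\left(1-\frac12\left\|\frac{A\varphi}{\|A\varphi\|}-[\operatorname{s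gn}(A\varphi|B\varphi)]\frac{B\varphi}{\|B\varphi\|}\right\|^2\right).\end{aligned}$$
   Context: The scalar product $(\cdot|\cdot):H\times H\to\mathbb{C}$ is linear in the first variable and antilinear in the second, and $\|u\|=(u|u)^{1/2}$. The commutator $[A,B]$ and anticommutator $\{A,B\}$ are understood as sesquilinear forms on $M=D(A)\cap D(B)$: for $\varphi,\psi\in M$, $$([A,B]\varphi|\psi)=(B\varphi|A\psi)-(A\varphi|B\psi),\qquad (\{A,B\}\varphi|\psi)=(B\varphi|A\psi)+(A\varphi|B\psi).$$ (The left-hand sides are notation for these forms; $AB\varphi$ and $BA\varphi$ need not be defined.) The sign function is $\operatorname{sgn}z=z/|z|$ for $z\in\mathbb{C}\setminus\{0\}$ and $\operatorname{sgn}0=1$. *)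

theory Defs
  imports Complex_Main
begin

text \<open>Complex vector spaces with a scalar product. Completeness is not assumed.\<close>

class complex_inner = ab_group_add +
  fixes scaleC :: "complex \<Rightarrow> 'a \<Rightarrow> 'a"  (infixr "*\<^sub>C" 75)
    and cinner :: "'a \<Rightarrow> 'a \<Rightarrow> complex"  ("\<langle>_, _\<rangle>")
  assumes scaleC_add_right: "a *\<^sub>C (x + y) = a *\<^sub>C x + a *\<^sub>C y"
    and scaleC_add_left: "(a + b) *\<^sub>C x = a *\<^sub>C x + b *\<^sub>C x"
    and scaleC_scaleC: "a *\<^sub>C (b *\<^sub>C x) = (a * b) *\<^sub>C x"
    and scaleC_one: "1 *\<^sub>C x = x"
    and cinner_add_left: "\<langle>x + y, z\<rangle> = \<langle>x, z\<rangle> + \<langle>y, z\<rangle>"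
    and cinner_scaleC_left: "\<langle>a *\<^sub>C x, y\<rangle> = a * \<langle>x, y\<rangle>"
    and cinner_commute: "\<langle>x, y\<rangle> = cnj \<langle>y, x\<rangle>"
    and cinner_ge_zero: "0 \<le> Re \<langle>x, x\<rangle>"
    and cinner_eq_zero_iff: "\<langle>x, x\<rangle> = 0 \<longleftrightarrow> x = 0"

global_interpretation complex_space: vector_space "scaleC :: complex \<Rightarrow> 'a \<Rightarrow> 'a::complex_inner"
  by unfold_locales (simp_all add: scaleC_add_right scaleC_add_left scaleC_scaleC scaleC_one)

abbreviation divideC :: "'a::complex_inner \<Rightarrow> real \<Rightarrow> 'a"  (infixl "'/\<^sub>C" 70)
  where "u /\<^sub>C r \<equiv> inverse (complex_of_real r) *\<^sub>C u"

text \<open>\<open>\<langle>u, u\<rangle>\<close> is real by \<open>cinner_commute\<close>, so taking the real part loses nothing.\<close>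

definition cnorm :: "'a::complex_inner \<Rightarrow> real"  ("\<parallel>_\<parallel>")
  where "\<parallel>u\<parallel> = sqrt (Re \<langle>u, u\<rangle>)"

text \<open>An operator in \<open>H\<close> is given by a total function together with its domain \<open>D\<close>;
  the values of the function outside \<open>D\<close> are irrelevant. The domain is a linear subspace,
  not required to be dense.\<close>

definition linear_operator :: "'a::complex_inner set \<Rightarrow> ('a \<Rightarrow> 'a) \<Rightarrow> bool"
  where "linear_operator D A \<longleftrightarrow> complex_space.subspace D \<and>
    (\<forall>u\<in>D. \<forall>v\<in>D. A (u + v) = A u + A v) \<and>
    (\<forall>c. \<forall>u\<in>D. A (c *\<^sub>C u) = c *\<^sub>C A u)"

definition symmetric_operator :: "'a::complex_inner set \<Rightarrow> ('a \<Rightarrow> 'a) \<Rightarrow> bool"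
  where "symmetric_operator D A \<longleftrightarrow> linear_operator D A \<and>
    (\<forall>u\<in>D. \<forall>v\<in>D. \<langle>A u, v\<rangle> = \<langle>u, A v\<rangle>)"

text \<open>The sesquilinear forms \<open>([A,B]\<phi>|\<psi>)\<close> and \<open>({A,B}\<phi>|\<psi>)\<close>; they are
  meaningful only for \<open>\<phi>\<close> and \<open>\<psi>\<close> in the intersection of the two domains.\<close>

definition commutator_form ::
    "('a::complex_inner \<Rightarrow> 'a) \<Rightarrow> ('a \<Rightarrow> 'a) \<Rightarrow> 'a \<Rightarrow> 'a \<Rightarrow> complex"
  where "commutator_form A B \<phi> \<psi> = \<langle>B \<phi>, A \<psi>\<rangle> - \<langle>A \<phi>, B \<psi>\<rangle>"

definition anticommutator_form ::
    "('a::complex_inner \<Rightarrow> 'a) \<Rightarrow> ('a \<Rightarrow> 'a) \<Rightarrow> 'a \<Rightarrow> 'a \<Rightarrow> complex"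
  where "anticommutator_form A B \<phi> \<psi> = \<langle>B \<phi>, A \<psi>\<rangle> + \<langle>A \<phi>, B \<psi>\<rangle>"

text \<open>Unlike the library function \<open>sgn\<close>, this takes the value 1 at 0.\<close>

definition csgn :: "complex \<Rightarrow> complex"
  where "csgn z = (if z = 0 then 1 else z / complex_of_real (cmod z))"

end

theory Submission
  imports Defs
begin

text \<open>Everything reduces to the polarization identity
  \<open>\<parallel>a\<parallel>\<parallel>b\<parallel> (1 - \<parallel>a/\<parallel>a\<parallel> + c b/\<parallel>b\<parallel>\<parallel>\<^sup>2 / 2) = - Re (cnj c \<langle>a, b\<rangle>)\<close> for \<open>|c| = 1\<close>.
  With \<open>a = A \<phi>\<close> and \<open>b = B \<phi>\<close>, the values \<open>c = \<plusminus>\<i>\<close> and \<open>c = \<plusminus>1\<close> produce the imaginary and the real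
  part of \<open>\<langle>a, b\<rangle>\<close>, hence the commutator and the anticommutator; \<open>c = e\<^sup>i\<^sup>\<theta>\<close> and \<open>c = \<plusminus>\<i> e\<^sup>i\<^sup>\<theta>\<close> produce
  the coordinates of a rotated copy of \<open>\<langle>a, b\<rangle>\<close>; and \<open>c = - sgn \<langle>a, b\<rangle>\<close> produces \<open>|\<langle>a, b\<rangle>|\<close>.\<close>

lemma cinner_add_right: "\<langle>x, y + z\<rangle> = \<langle>x, y\<rangle> + \<langle>x, z\<rangle>" for x :: "'a::complex_inner"
  by (metis cinner_add_left cinner_commute complex_cnj_add)

lemma cinner_scaleC_right: "\<langle>x, c *\<^sub>C y\<rangle> = cnj c * \<langle>x, y\<rangle>" for x :: "'a::complex_inner"
  by (metis cinner_scaleC_left cinner_commute complex_cnj_mult)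

lemma cinner_self: "\<langle>x, x\<rangle> = complex_of_real (\<parallel>x\<parallel>\<^sup>2)" for x :: "'a::complex_inner"
proof -
  have "Im \<langle>x, x\<rangle> = 0"
    using cinner_commute[of x x] by (simp add: complex_eq_iff)
  then show ?thesis
    by (simp add: cnorm_def cinner_ge_zero complex_eq_iff)
qed

lemma cnorm_pos: "x \<noteq> 0 \<Longrightarrow> 0 < \<parallel>x\<parallel>" for x :: "'a::complex_inner"
  using cinner_self[of x] cinner_eq_zero_iff[of x] cinner_ge_zero[of x]
  by (auto simp: cnorm_def less_le)

text \<open>Sesquilinear expansion leaves two cross terms that are conjugate to each other, hence
  add up to twice a real part. The expansion is done in the complex numbers and pulled back along
  the injective \<open>complex_of_real\<close>.\<close>

lemma cnorm_add_scaleC_square: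
  fixes x y :: "'a::complex_inner"
  shows "\<parallel>x + c *\<^sub>C y\<parallel>\<^sup>2 = \<parallel>x\<parallel>\<^sup>2 + (cmod c)\<^sup>2 * \<parallel>y\<parallel>\<^sup>2 + 2 * Re (cnj c * \<langle>x, y\<rangle>)"
proof -
  have "complex_of_real (\<parallel>x + c *\<^sub>C y\<parallel>\<^sup>2)
      = \<langle>x, x\<rangle> + c * cnj c * \<langle>y, y\<rangle> + (cnj c * \<langle>x, y\<rangle> + cnj (cnj c * \<langle>x, y\<rangle>))"
    unfolding cinner_self[symmetric] using cinner_commute[of y x]
    by (simp add: cinner_add_left cinner_add_right cinner_scaleC_left cinner_scaleC_right
        algebra_simps)
  also have "\<dots> = complex_of_real
      (\<parallel>x\<parallel>\<^sup>2 + (cmod c)\<^sup>2 * \<parallel>y\<parallel>\<^sup>2 + 2 * Re (cnj c * \<langle>x, y\<rangle>))"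
    unfolding complex_add_cnj cinner_self complex_norm_square[symmetric] by simp
  finally show ?thesis
    unfolding of_real_eq_iff .
qed

lemma cnorm_normalize: "x \<noteq> 0 \<Longrightarrow> \<parallel>x /\<^sub>C \<parallel>x\<parallel>\<parallel> = 1" for x :: "'a::complex_inner"
proof -
  assume "x \<noteq> 0"
  then have "0 < \<parallel>x\<parallel>"
    by (rule cnorm_pos)
  then have "\<langle>x /\<^sub>C \<parallel>x\<parallel>, x /\<^sub>C \<parallel>x\<parallel>\<rangle> = 1"
    unfolding cinner_scaleC_left cinner_scaleC_right cinner_self[of x]
    by (simp add: power2_eq_square field_simps)
  then show ?thesis
    by (simp add: cnorm_def)
qed

text \<open>Both normalized vectors have norm 1 and \<open>c\<close> is unimodular, so the expanded
  square is 2 plus a cross term with denominator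
  \<open>\<parallel>a\<parallel> * \<parallel>b\<parallel>\<close>; the outer factor cancels that
  denominator.\<close>

lemma polarization_normalized:
  fixes a b :: "'a::complex_inner"
  assumes "a \<noteq> 0" "b \<noteq> 0" "cmod c = 1"
  shows "\<parallel>a\<parallel> * \<parallel>b\<parallel> * (1 - 1 / 2 * \<parallel>a /\<^sub>C \<parallel>a\<parallel> + c *\<^sub>C (b /\<^sub>C \<parallel>b\<parallel>)\<parallel>\<^sup>2) = - Re (cnj c * \<langle>a, b\<rangle>)"
proof -
  have "\<langle>a /\<^sub>C \<parallel>a\<parallel>, b /\<^sub>C \<parallel>b\<parallel>\<rangle> = \<langle>a, b\<rangle> / complex_of_real (\<parallel>a\<parallel> * \<parallel>b\<parallel>)"
    by (simp add: cinner_scaleC_left cinner_scaleC_right divide_simps)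
  then have "\<parallel>a /\<^sub>C \<parallel>a\<parallel> + c *\<^sub>C (b /\<^sub>C \<parallel>b\<parallel>)\<parallel>\<^sup>2
      = 2 + 2 * Re (cnj c * \<langle>a, b\<rangle> / complex_of_real (\<parallel>a\<parallel> * \<parallel>b\<parallel>))"
    by (simp only: cnorm_add_scaleC_square cnorm_normalize[OF assms(1)] cnorm_normalize[OF assms(2)]
        assms(3)) simp
  then show ?thesis
    using cnorm_pos[OF assms(1)] cnorm_pos[OF assms(2)]
    by (simp only: Re_divide_of_real) (simp add: field_simps)
qed

lemma cmod_csgn: "cmod (csgn z) = 1"
  by (simp add: csgn_def norm_divide)

text \<open>Conjugate multiplication by the sign rotates \<open>z\<close> onto the nonnegative real
  axis; at 0 both sides vanish.\<close>

lemma cnj_csgn_mult: "cnj (csgn z) * z = complex_of_real (cmod z)"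
proof (cases "z = 0")
  case False
  have "cnj z * z = complex_of_real (cmod z) * complex_of_real (cmod z)"
    using complex_norm_square[of z] by (simp add: power2_eq_square mult.commute)
  then show ?thesis
    using False by (simp add: csgn_def)
qed (simp add: csgn_def)

theorem theorem2p1:
  fixes A B :: "'h::complex_inner \<Rightarrow> 'h" and D\<^sub>A D\<^sub>B M :: "'h set" and \<phi> :: 'h
  assumes "symmetric_operator D\<^sub>A A"
    and "symmetric_operator D\<^sub>B B"
    and "M = D\<^sub>A \<inter> D\<^sub>B"
    and "M \<noteq> {0}"
    and "\<phi> \<in> M"
    and "A \<phi> \<noteq> 0"
    and "B \<phi> \<noteq> 0"
  shows
    "(\<i> * commutator_form A B \<phi> \<phi> = complex_of_real
        (\<parallel>A \<phi>\<parallel> * \<parallel>B \<phi>\<parallel> * (2 - \<parallel>A \<phi> /\<^sub>C \<parallel>A \<phi>\<parallel> - \<i> *\<^sub>C (B \<phi> /\<^sub>C \<parallel>B \<phi>\<parallel>)\<parallel>\<^sup>2)) \<and>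
      - \<i> * commutator_form A B \<phi> \<phi> = complex_of_real
        (\<parallel>A \<phi>\<parallel> * \<parallel>B \<phi>\<parallel> * (2 - \<parallel>A \<phi> /\<^sub>C \<parallel>A \<phi>\<parallel> + \<i> *\<^sub>C (B \<phi> /\<^sub>C \<parallel>B \<phi>\<parallel>)\<parallel>\<^sup>2))) \<and>
     (anticommutator_form A B \<phi> \<phi> = complex_of_real
        (\<parallel>A \<phi>\<parallel> * \<parallel>B \<phi>\<parallel> * (2 - \<parallel>A \<phi> /\<^sub>C \<parallel>A \<phi>\<parallel> - B \<phi> /\<^sub>C \<parallel>B \<phi>\<parallel>\<parallel>\<^sup>2)) \<and>
      - anticommutator_form A B \<phi> \<phi> = complex_of_real
        (\<parallel>A \<phi>\<parallel> * \<parallel>B \<phi>\<parallel> * (2 - \<parallel>A \<phi> /\<^sub>C \<parallel>A \<phi>\<parallel> + B \<phi> /\<^sub>C \<parallel>B \<phi>\<parallel>\<parallel>\<^sup>2))) \<and>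
     (\<forall>\<theta>::real. \<forall>\<epsilon>\<in>{1, - 1 :: complex}.
        cmod \<langle>A \<phi>, B \<phi>\<rangle>
          = 1 / 2 * sqrt ((cmod (commutator_form A B \<phi> \<phi>))\<^sup>2
                          + (cmod (anticommutator_form A B \<phi> \<phi>))\<^sup>2) \<and>
        cmod \<langle>A \<phi>, B \<phi>\<rangle>
          = \<parallel>A \<phi>\<parallel> * \<parallel>B \<phi>\<parallel> * sqrt
              ((1 - 1 / 2 * \<parallel>A \<phi> /\<^sub>C \<parallel>A \<phi>\<parallel>
                  + exp (\<i> * complex_of_real \<theta>) *\<^sub>C (B \<phi> /\<^sub>C \<parallel>B \<phi>\<parallel>)\<parallel>\<^sup>2)\<^sup>2
               + (1 - 1 / 2 * \<parallel>A \<phi> /\<^sub>C \<parallel>A \<phi>\<parallel>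
                  + (\<epsilon> * \<i> * exp (\<i> * complex_of_real \<theta>)) *\<^sub>C (B \<phi> /\<^sub>C \<parallel>B \<phi>\<parallel>)\<parallel>\<^sup>2)\<^sup>2) \<and>
        cmod \<langle>A \<phi>, B \<phi>\<rangle>
          = \<parallel>A \<phi>\<parallel> * \<parallel>B \<phi>\<parallel> * (1 - 1 / 2 *
              \<parallel>A \<phi> /\<^sub>C \<parallel>A \<phi>\<parallel> - csgn \<langle>A \<phi>, B \<phi>\<rangle> *\<^sub>C (B \<phi> /\<^sub>C \<parallel>B \<phi>\<parallel>)\<parallel>\<^sup>2))"
proof -
  let ?a = "A \<phi>" and ?b = "B \<phi>"
  define z where "z = \<langle>?a, ?b\<rangle>"
  \<comment> \<open>Every squared norm in the claim becomes \<open>2 - 2 * q c\<close> for a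
    unimodular \<open>c\<close>, so \<open>pol\<close> alone evaluates them all.\<close>
  define q where "q c = 1 - 1 / 2 * \<parallel>?a /\<^sub>C \<parallel>?a\<parallel> + c *\<^sub>C (?b /\<^sub>C \<parallel>?b\<parallel>)\<parallel>\<^sup>2" for c
  have pol: "\<parallel>?a\<parallel> * \<parallel>?b\<parallel> * q c = - Re (cnj c * z)" if "cmod c = 1" for c
    unfolding q_def z_def using polarization_normalized[OF assms(6,7) that] .
  have q: "\<parallel>?a /\<^sub>C \<parallel>?a\<parallel> + c *\<^sub>C (?b /\<^sub>C \<parallel>?b\<parallel>)\<parallel>\<^sup>2 = 2 - 2 * q c" for c
    by (simp add: q_def)
  have q_minus: "\<parallel>?a /\<^sub>C \<parallel>?a\<parallel> - c *\<^sub>C (?b /\<^sub>C \<parallel>?b\<parallel>)\<parallel>\<^sup>2 = 2 - 2 * q (- c)" for c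
    unfolding q[symmetric] complex_space.scale_minus_left by simp
  have q_one: "\<parallel>?a /\<^sub>C \<parallel>?a\<parallel> + ?b /\<^sub>C \<parallel>?b\<parallel>\<parallel>\<^sup>2 = 2 - 2 * q 1"
    "\<parallel>?a /\<^sub>C \<parallel>?a\<parallel> - ?b /\<^sub>C \<parallel>?b\<parallel>\<parallel>\<^sup>2 = 2 - 2 * q (- 1)"
    using q[of 1] q_minus[of 1] by (simp_all only: scaleC_one)
  \<comment> \<open>Since \<open>\<langle>B \<phi>, A \<phi>\<rangle>\<close> is
    \<open>cnj z\<close>, the two forms are \<open>cnj z - z\<close> and
    \<open>cnj z + z\<close>.\<close>
  have comm: "commutator_form A B \<phi> \<phi> = - 2 * \<i> * Im z"
    using cinner_commute[of ?b ?a] by (simp add: commutator_form_def z_def complex_eq_iff)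
  have anti: "anticommutator_form A B \<phi> \<phi> = 2 * Re z"
    using cinner_commute[of ?b ?a] by (simp add: anticommutator_form_def z_def complex_eq_iff)
  have double: "\<parallel>?a\<parallel> * \<parallel>?b\<parallel> * (2 - (2 - 2 * q c)) = - 2 * Re (cnj c * z)" if "cmod c = 1" for c
    using pol[OF that] by simp
  have half: "1 - 1 / 2 * (2 - 2 * q c) = q c" for c
    by (simp add: field_simps)
  have forms: "cmod z = 1 / 2 * sqrt ((cmod (commutator_form A B \<phi> \<phi>))\<^sup>2
      + (cmod (anticommutator_form A B \<phi> \<phi>))\<^sup>2)"
  proof -
    have "(cmod (commutator_form A B \<phi> \<phi>))\<^sup>2 + (cmod (anticommutator_form A B \<phi> \<phi>))\<^sup>2
        = (2 * cmod z)\<^sup>2"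
      by (simp add: comm anti norm_mult cmod_power2 power_mult_distrib)
    then show ?thesis
      by (simp only: real_sqrt_abs) simp
  qed
  have rotated: "cmod z = \<parallel>?a\<parallel> * \<parallel>?b\<parallel> * sqrt ((q u)\<^sup>2 + (q (\<epsilon> * \<i> * u))\<^sup>2)"
    if u: "cmod u = 1" and \<epsilon>: "\<epsilon> \<in> {1, - 1}" for u \<epsilon>
  proof -
    have v: "cmod (\<epsilon> * \<i> * u) = 1"
      using u \<epsilon> by (auto simp: norm_mult)
    \<comment> \<open>The norms are positive, so their product may move under the root.\<close>
    have "\<parallel>?a\<parallel> * \<parallel>?b\<parallel> * sqrt ((q u)\<^sup>2 + (q (\<epsilon> * \<i> * u))\<^sup>2)
        = sqrt ((\<parallel>?a\<parallel> * \<parallel>?b\<parallel> * q u)\<^sup>2 + (\<parallel>?a\<parallel> * \<parallel>?b\<parallel> * q (\<epsilon> * \<i> * u))\<^sup>2)"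
      using cnorm_pos[OF assms(6)] cnorm_pos[OF assms(7)]
      by (simp add: power_mult_distrib real_sqrt_mult flip: distrib_left)
    also have "\<dots> = sqrt ((Re (cnj u * z))\<^sup>2 + (Re (cnj (\<epsilon> * \<i> * u) * z))\<^sup>2)"
      by (simp only: pol[OF u] pol[OF v] power2_minus)
    \<comment> \<open>The factor \<open>\<epsilon> * \<i>\<close> is a quarter turn: it exchanges
      real and imaginary part up to a sign, which squaring removes.\<close>
    also have "(Re (cnj (\<epsilon> * \<i> * u) * z))\<^sup>2 = (Im (cnj u * z))\<^sup>2"
      using \<epsilon> by (auto simp: power2_eq_square algebra_simps)
    also have "sqrt ((Re (cnj u * z))\<^sup>2 + (Im (cnj u * z))\<^sup>2) = cmod (cnj u * z)"
      by (simp only: cmod_def)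
    finally show ?thesis
      using u by (simp add: norm_mult)
  qed
  \<comment> \<open>This \<open>c\<close> gives \<open>cnj c * z = - cmod z\<close>, the most
    negative value possible.\<close>
  have aligned: "cmod z = \<parallel>?a\<parallel> * \<parallel>?b\<parallel> * q (- csgn z)"
    using pol[of "- csgn z"] by (simp add: cmod_csgn cnj_csgn_mult)
  show ?thesis
    unfolding z_def[symmetric] q q_minus q_one half
  proof (intro conjI allI ballI)
    fix \<theta> :: real and \<epsilon> :: complex
    assume "\<epsilon> \<in> {1, - 1}"
    show "cmod z = \<parallel>?a\<parallel> * \<parallel>?b\<parallel> *
        sqrt ((q (exp (\<i> * \<theta>)))\<^sup>2 + (q (\<epsilon> * \<i> * exp (\<i> * \<theta>)))\<^sup>2)"
      \<comment> \<open>Written as \<open>cis \<theta>\<close>, the exponential is visibly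
        unimodular.\<close>
      using rotated \<open>\<epsilon> \<in> {1, - 1}\<close> by (simp flip: cis_conv_exp)
  \<comment> \<open>The four signed identities are \<open>double\<close> at \<open>c\<close> equal
    to \<open>- \<i>\<close>, \<open>\<i>\<close>, \<open>- 1\<close> and \<open>1\<close>, compared
    with \<open>comm\<close> and \<open>anti\<close>.\<close>
  qed (rule forms aligned
      | simp only: double comm anti norm_minus_cancel norm_ii norm_one, simp add: complex_eq_iff)+
qed

end
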